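(* Let $G$ be a triangle-free $2$-connected graph with no induced subgraph isomorphic to a theta, a closed theta, or a wheel. Then $G$ has a Hamiltonian cycle.
   Context: Graphs are finite, without loops or parallel edges. A Hamiltonian cycle of $G$ is a (not necessarily induced) subgraph of $G$ which is a cycle containing every vertex of $G$. A graph is triangle-free if it contains no clique on three vertices. A theta is a graph consisting of two non-adjacent vertices $u,v$ (the ends) and three paths $P_1,P_2,P_3$ from $u$ to $v$, each of length at least two, such that the sets $V(P_i)\setminus\{u,v\}$ ($i=1,2,3$) are pairwise disjoint and there are no edges between any two of them (and no other edges). A closed theta is the graph obtained from a theta with ends $u,v$ by adding the edge $uv$. A wheel is the graph consisting of a cycle $W$ together with a vertex $v \notin V(W)$ having at least three neighbours in $W$, whose edges are the edges of $W$ and the edges from $v$ to its neighbours in $W$ (so $W$ is an induced cycle of the wheel). *)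

theory Defs
  imports "Graph_Theory.Graph_Theory"
begin

text \<open>
  A finite simple graph is a \<open>pair_graph\<close>: an undirected edge \<open>uv\<close> is represented by the two
  arcs \<open>(u, v)\<close> and \<open>(v, u)\<close>.
\<close>

definition walk_graph :: "'a list \<Rightarrow> 'a pair_pre_digraph" where
  "walk_graph p = \<lparr> pverts = set p, parcs = set (vwalk_arcs p) \<union> (set (vwalk_arcs p))\<inverse> \<rparr>"

definition is_cycle :: "'a pair_pre_digraph \<Rightarrow> bool" where
  "is_cycle C \<longleftrightarrow> (\<exists>p. distinct p \<and> length p \<ge> 3 \<and> C = walk_graph (p @ [hd p]))"

definition hamiltonian_cycle :: "'a pair_pre_digraph \<Rightarrow> 'a pair_pre_digraph \<Rightarrow> bool" where
  "hamiltonian_cycle C G \<longleftrightarrow> is_cycle C \<and> spanning C G"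

definition triangle_free :: "'a pair_pre_digraph \<Rightarrow> bool" where
  "triangle_free G \<longleftrightarrow> \<not> (\<exists>T :: 'a pair_pre_digraph. subgraph T G \<and> complete_digraph 3 T)"

text \<open>
  The usual convention that a \<open>k\<close>-connected graph has more than \<open>k\<close> vertices; in particular an
  edge is not 2-connected.
\<close>

definition k_connected :: "nat \<Rightarrow> 'a pair_pre_digraph \<Rightarrow> bool" where
  "k_connected k G \<longleftrightarrow> card (pverts G) > k \<and>
     (\<forall>X \<subseteq> pverts G. card X < k \<longrightarrow> connected (with_proj G \<restriction> (pverts G - X)))"

text \<open>
  A path of length at least two has at least three vertices. Since the graph is exactly the union
  of the three paths, the ends are non-adjacent and there are no edges between the interiors of
  different paths.
\<close>

definition theta_with_ends :: "'a \<Rightarrow> 'a \<Rightarrow> 'a pair_pre_digraph \<Rightarrow> bool" where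
  "theta_with_ends u v T \<longleftrightarrow> (\<exists>p1 p2 p3.
     (\<forall>p \<in> {p1, p2, p3}. distinct p \<and> length p \<ge> 3 \<and> hd p = u \<and> last p = v) \<and>
     disjnt (set p1 - {u, v}) (set p2 - {u, v}) \<and>
     disjnt (set p1 - {u, v}) (set p3 - {u, v}) \<and>
     disjnt (set p2 - {u, v}) (set p3 - {u, v}) \<and>
     T = \<lparr> pverts = set p1 \<union> set p2 \<union> set p3,
           parcs = parcs (walk_graph p1) \<union> parcs (walk_graph p2) \<union> parcs (walk_graph p3) \<rparr>)"

definition is_theta :: "'a pair_pre_digraph \<Rightarrow> bool" where
  "is_theta T \<longleftrightarrow> (\<exists>u v. theta_with_ends u v T)"

definition is_closed_theta :: "'a pair_pre_digraph \<Rightarrow> bool" where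
  "is_closed_theta H \<longleftrightarrow> (\<exists>u v T. theta_with_ends u v T \<and>
     H = \<lparr> pverts = pverts T, parcs = parcs T \<union> {(u, v), (v, u)} \<rparr>)"

definition is_wheel :: "'a pair_pre_digraph \<Rightarrow> bool" where
  "is_wheel H \<longleftrightarrow> (\<exists>W v N. is_cycle W \<and> v \<notin> pverts W \<and> N \<subseteq> pverts W \<and> card N \<ge> 3 \<and>
     H = \<lparr> pverts = insert v (pverts W), parcs = parcs W \<union> {v} \<times> N \<union> N \<times> {v} \<rparr>)"

text \<open>
  Letting the pattern \<open>F\<close> range over graphs on the vertex type of \<open>G\<close> is no restriction: any graph
  isomorphic to a subgraph of \<open>G\<close> has a copy on that type.
\<close>

definition has_induced :: "('a pair_pre_digraph \<Rightarrow> bool) \<Rightarrow> 'a pair_pre_digraph \<Rightarrow> bool" where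
  "has_induced P G \<longleftrightarrow> (\<exists>H F :: 'a pair_pre_digraph. induced_subgraph H G \<and> P F \<and> digraph_iso H F)"

end

theory Submission
  imports Defs
begin

text \<open>
  A longest cycle that misses a vertex has an ear, and the ends of the ear are not consecutive on
  the cycle; so a non-Hamiltonian 2-connected graph has three internally disjoint paths of length at
  least two with common ends \<open>u\<close>, \<open>v\<close>. Among all such configurations choose one with the fewest
  vertices. Its paths have no chords apart from possibly \<open>uv\<close>. An edge \<open>xy\<close> between the interiors
  of two of the paths yields a subdivision of \<open>K\<^sub>4\<close>; minimality applied to the other configurations
  in it, together with the absence of triangles, forces one of the two paths to be, say, \<open>u, y, v\<close>
  and \<open>x\<close> to be adjacent to neither \<open>u\<close> nor \<open>v\<close> on the other. By minimality again the two paths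
  avoiding \<open>y\<close> form an induced cycle, and \<open>y\<close> is the centre of a wheel. Without such edges the
  configuration is an induced theta or closed theta.
\<close>

section \<open>Vertex lists and their arcs\<close>

lemma in_vwalk_arcs_iff: "(x, y) \<in> set (vwalk_arcs p) \<longleftrightarrow> (\<exists>p1 p2. p = p1 @ x # y # p2)"
proof (induction p rule: vwalk_arcs.induct)
  case (3 a b p)
  show ?case
  proof
    assume "(x, y) \<in> set (vwalk_arcs (a # b # p))"
    then consider "x = a" "y = b" | "(x, y) \<in> set (vwalk_arcs (b # p))" by auto
    then show "\<exists>p1 p2. a # b # p = p1 @ x # y # p2"
    proof cases
      case 1
      then have "a # b # p = [] @ x # y # p" by simp
      then show ?thesis by blast
    next
      case 2
      then show ?thesis by (metis 3 append_Cons)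
    qed
  next
    assume "\<exists>p1 p2. a # b # p = p1 @ x # y # p2"
    then obtain p1 p2 where *: "a # b # p = p1 @ x # y # p2" by blast
    show "(x, y) \<in> set (vwalk_arcs (a # b # p))"
    proof (cases p1)
      case Nil
      then show ?thesis using * by simp
    next
      case (Cons z q)
      then have "b # p = q @ x # y # p2" using * by simp
      then have "(x, y) \<in> set (vwalk_arcs (b # p))" using 3 by blast
      then show ?thesis by simp
    qed
  qed
qed auto

lemma vwalk_arcs_append_Cons: "vwalk_arcs (p @ x # q) = vwalk_arcs (p @ [x]) @ vwalk_arcs (x # q)"
  by (induction p rule: vwalk_arcs.induct) auto

lemma successively_iff_vwalk_arcs:
  "successively P p \<longleftrightarrow> (\<forall>(x, y) \<in> set (vwalk_arcs p). P x y)"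
  by (induction P p rule: successively.induct) auto

text \<open>The arcs of \<open>walk_graph\<close> are closed under converse, so traversing
  \<open>c\<close> backwards on the return from \<open>v\<close> to \<open>u\<close> leaves the arcs
  unchanged. This identifies the rim of the wheel with the union of two of the three paths.\<close>

lemma parcs_walk_graph_cycle:
  "parcs (walk_graph (u # a @ v # rev c @ [u]))
    = parcs (walk_graph (u # a @ [v])) \<union> parcs (walk_graph (u # c @ [v]))"
proof -
  have "vwalk_arcs (u # a @ v # rev c @ [u])
      = vwalk_arcs (u # a @ [v]) @ vwalk_arcs (rev (u # c @ [v]))"
    using vwalk_arcs_append_Cons[of "u # a" v "rev c @ [u]"] by simp
  then show ?thesis
    unfolding walk_graph_def by (auto simp: set_vwalk_arcs_rev simp del: rev.simps rev_append)
qed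

lemma split_list_two:
  assumes "x \<in> set l" "y \<in> set l" "x \<noteq> y"
  obtains l1 l2 l3 where "l = l1 @ x # l2 @ y # l3" | l1 l2 l3 where "l = l1 @ y # l2 @ x # l3"
proof -
  obtain k1 k2 where k: "l = k1 @ x # k2" using assms(1) by (metis split_list)
  then consider "y \<in> set k1" | "y \<in> set k2" using assms by auto
  then show ?thesis
  proof cases
    case 1
    then obtain m1 m2 where "k1 = m1 @ y # m2" by (metis split_list)
    then show ?thesis using that(2) k by simp
  next
    case 2
    then obtain m1 m2 where "k2 = m1 @ y # m2" by (metis split_list)
    then show ?thesis using that(1) k by simp
  qed
qed

lemma list_hd_inner_last:
  assumes "length l \<ge> 3"
  obtains a where "a \<noteq> []" "l = hd l # a @ [last l]"
proof -
  obtain h t where l: "l = h # t" using assms by (cases l) auto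
  then have "t \<noteq> []" using assms by auto
  then have "l = hd l # butlast t @ [last l]" using l by simp
  moreover have "length (butlast t) > 0" using assms l by simp
  then have "butlast t \<noteq> []" by blast
  ultimately show ?thesis using that by blast
qed

section \<open>Smallest three-path configurations\<close>

locale triangle_free_relation =
  fixes E :: "'a \<Rightarrow> 'a \<Rightarrow> bool"
  assumes sym: "E x y \<Longrightarrow> E y x"
    and irrefl: "\<not> E x x"
    and no_triangle: "E x y \<Longrightarrow> E y z \<Longrightarrow> \<not> E z x"
begin

lemma sym_iff: "E x y \<longleftrightarrow> E y x"
  using sym by blast

abbreviation walk :: "'a list \<Rightarrow> bool" where
  "walk \<equiv> successively E"

lemma walk_rev [simp]: "walk (rev p) \<longleftrightarrow> walk p"
proof -
  have "(\<lambda>x y. E y x) = E" using sym by blast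
  then show ?thesis unfolding successively_rev by (rule arg_cong)
qed

lemma walk_append_Cons: "walk (p @ x # q) \<longleftrightarrow> walk (p @ [x]) \<and> walk (x # q)"
  by (auto simp: successively_append_iff)

text \<open>The lists \<open>a\<close>, \<open>b\<close>, \<open>c\<close> are the interiors of the three paths; further edges are allowed.\<close>

definition three_paths :: "'a \<Rightarrow> 'a \<Rightarrow> 'a list \<Rightarrow> 'a list \<Rightarrow> 'a list \<Rightarrow> bool" where
  "three_paths u v a b c \<longleftrightarrow> distinct (u # v # a @ b @ c) \<and> a \<noteq> [] \<and> b \<noteq> [] \<and> c \<noteq> [] \<and>
     walk (u # a @ [v]) \<and> walk (u # b @ [v]) \<and> walk (u # c @ [v])"

text \<open>The total interior length is the number of vertices minus two. The comparison ranges
  over all pairs of ends, since the competing configurations constructed below have new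
  ends.\<close>

definition min_three_paths :: "'a \<Rightarrow> 'a \<Rightarrow> 'a list \<Rightarrow> 'a list \<Rightarrow> 'a list \<Rightarrow> bool" where
  "min_three_paths u v a b c \<longleftrightarrow> three_paths u v a b c \<and>
     (\<forall>u' v' a' b' c'. three_paths u' v' a' b' c' \<longrightarrow>
        length a + length b + length c \<le> length a' + length b' + length c')"

lemma min_three_pathsD:
  assumes "min_three_paths u v a b c"
  shows "three_paths u v a b c"
    and "three_paths u' v' a' b' c' \<Longrightarrow>
      length a + length b + length c \<le> length a' + length b' + length c'"
  using assms unfolding min_three_paths_def by blast+

lemma three_paths_swap12: "three_paths u v a b c \<Longrightarrow> three_paths u v b a c"
  and three_paths_swap23: "three_paths u v a b c \<Longrightarrow> three_paths u v a c b"
  unfolding three_paths_def by auto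

text \<open>These two transpositions generate all orders of the three paths, so facts proved for
  paths in fixed positions transfer to the others.\<close>

lemma min_three_paths_swap12: "min_three_paths u v a b c \<Longrightarrow> min_three_paths u v b a c"
  and min_three_paths_swap23: "min_three_paths u v a b c \<Longrightarrow> min_three_paths u v a c b"
  unfolding min_three_paths_def using three_paths_swap12 three_paths_swap23
  by (metis add.commute, metis add.assoc add.commute)

lemma ex_min_three_paths:
  assumes "three_paths u v a b c"
  obtains u' v' a' b' c' where "min_three_paths u' v' a' b' c'"
proof -
  define P where
    "P n \<longleftrightarrow> (\<exists>u v a b c. three_paths u v a b c \<and> n = length a + length b + length c)" for n
  have "\<exists>n. P n" using assms unfolding P_def by blast
  then have "P (LEAST n. P n)" by (rule LeastI_ex)
  then obtain u' v' a' b' c' where t: "three_paths u' v' a' b' c'"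
    and n: "(LEAST n. P n) = length a' + length b' + length c'"
    unfolding P_def by blast
  have "length a' + length b' + length c' \<le> length a'' + length b'' + length c''"
    if "three_paths u'' v'' a'' b'' c''" for u'' v'' a'' b'' c''
    unfolding n[symmetric] by (rule Least_le) (use that P_def in blast)
  then have "min_three_paths u' v' a' b' c'" using t unfolding min_three_paths_def by blast
  then show ?thesis by (rule that)
qed

text \<open>Skipping \<open>l2\<close> along the edge \<open>x y\<close> would give a smaller
  configuration with the same ends. The last assumption excludes the edge joining the two ends, for
  which the shortened path would have an empty interior.\<close>

lemma min_three_paths_shortcut:
  assumes min: "min_three_paths u v a b c" and l: "u # a @ [v] = l1 @ x # l2 @ y # l3"
    and "E x y" and "l1 \<noteq> [] \<or> l3 \<noteq> []"
  shows "l2 = []"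
proof (rule ccontr)
  assume l2: "l2 \<noteq> []"
  let ?l = "l1 @ x # y # l3"
  note t = min_three_pathsD(1)[OF min, unfolded three_paths_def]
  have hd: "hd ?l = u" using l by (cases l1) auto
  have last: "last ?l = v"
    using l by (metis last.simps last_ConsR last_append list.distinct(1) append_is_Nil_conv)
  have "length ?l \<ge> 3" using assms(4) by (cases l1; cases l3) auto
  then obtain a' where a': "a' \<noteq> []" "?l = u # a' @ [v]"
    using list_hd_inner_last[of ?l] hd last by metis
  have "distinct (l1 @ x # l2 @ y # l3)" using t unfolding l[symmetric] by auto
  then have "distinct ?l" by auto
  then have dist: "distinct (u # a' @ [v])" unfolding a'(2) .
  have "set (u # a' @ [v]) \<subseteq> set (u # a @ [v])" unfolding l a'(2)[symmetric] by auto
  then have sub: "set a' \<subseteq> set a" using dist by auto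
  have "walk (l1 @ x # l2 @ y # l3)" using t unfolding l[symmetric] by simp
  then have "walk ?l"
    using \<open>E x y\<close> walk_append_Cons[of l1 x "l2 @ y # l3"] walk_append_Cons[of "x # l2" y l3]
      walk_append_Cons[of l1 x "y # l3"] by simp
  then have "walk (u # a' @ [v])" unfolding a'(2) .
  then have "three_paths u v a' b c"
    using t dist sub a'(1) unfolding three_paths_def by auto
  then have "length a \<le> length a'" using min_three_pathsD(2)[OF min] by fastforce
  moreover have "length (u # a @ [v]) = length (u # a' @ [v]) + length l2"
    unfolding l a'(2)[symmetric] by simp
  ultimately show False using l2 by simp
qed

text \<open>Whichever of \<open>x\<close> and \<open>y\<close> comes first on the path, the shortcut
  argument leaves nothing between them. The order is then immaterial, because
  \<open>walk_graph\<close> contains both directions of each edge.\<close>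

lemma min_three_paths_chordless:
  assumes min: "min_three_paths u v a b c" and "x \<in> set (u # a @ [v])" "y \<in> set (u # a @ [v])"
    and "E x y" and "{x, y} \<noteq> {u, v}"
  shows "(x, y) \<in> parcs (walk_graph (u # a @ [v]))"
proof -
  have arc: "(s, t) \<in> set (vwalk_arcs (u # a @ [v]))"
    if l: "u # a @ [v] = l1 @ s # l2 @ t # l3" and st: "E s t" "{s, t} \<noteq> {u, v}" for l1 l2 l3 s t
  proof -
    have "l1 \<noteq> [] \<or> l3 \<noteq> []" using l st(2) by auto
    then have "l2 = []" using min_three_paths_shortcut[OF min l st(1)] by blast
    then show ?thesis using l in_vwalk_arcs_iff by fastforce
  qed
  have "x \<noteq> y" using \<open>E x y\<close> irrefl by blast
  from split_list_two[OF assms(2,3) this]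
  consider (before) l1 l2 l3 where "u # a @ [v] = l1 @ x # l2 @ y # l3"
    | (after) l1 l2 l3 where "u # a @ [v] = l1 @ y # l2 @ x # l3" by metis
  then show ?thesis
  proof cases
    case before
    then show ?thesis using arc[OF before] assms(4,5) unfolding walk_graph_def by simp
  next
    case after
    have "(y, x) \<in> set (vwalk_arcs (u # a @ [v]))"
      using arc[OF after sym[OF assms(4)]] assms(5) by (simp add: insert_commute)
    then show ?thesis unfolding walk_graph_def by simp
  qed
qed

text \<open>Deleting the path from \<open>u\<close> to \<open>x\<close> leaves three paths between \<open>y\<close> and \<open>v\<close>.\<close>

lemma min_three_paths_opposite:
  assumes min: "min_three_paths u v (a1 @ x # a2) (b1 @ y # b2) c" and "E x y" and "b2 \<noteq> []"
  shows "a1 = []"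
proof -
  note t = min_three_pathsD(1)[OF min, unfolded three_paths_def]
  have b: "walk (u # b1 @ [y])" "walk (y # b2 @ [v])"
    using t walk_append_Cons[of "u # b1" y "b2 @ [v]"] by simp_all
  have "walk (x # a2 @ [v])"
    using t walk_append_Cons[of "u # a1" x "a2 @ [v]"] by simp
  then have "walk (y # (x # a2) @ [v])" using sym[OF assms(2)] by simp
  moreover have "walk (rev (u # b1 @ [y]))" using b(1) unfolding walk_rev .
  then have "walk (y # (rev b1 @ u # c) @ [v])"
    using t walk_append_Cons[of "y # rev b1" u "c @ [v]"] by simp
  ultimately have "three_paths y v b2 (x # a2) (rev b1 @ u # c)"
    using t b(2) assms(3) unfolding three_paths_def by auto
  \<comment> \<open>Here \<open>u\<close> has become an interior vertex and \<open>y\<close> an end,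
    so the new configuration has all the old vertices except those of \<open>a1\<close>. Minimality
    leaves \<open>length a1 \<le> 0\<close>.\<close>
  from min_three_pathsD(2)[OF min this] show ?thesis by simp
qed

text \<open>The previous lemma, applied from both sides of the edge, gives two implications; a
  triangle at \<open>u\<close> or at \<open>v\<close> excludes \<open>a1 = b1 = []\<close> and
  \<open>a2 = b2 = []\<close>. Only the two listed cases survive.\<close>

lemma min_three_paths_cross_edge:
  assumes min: "min_three_paths u v (a1 @ x # a2) (b1 @ y # b2) c" and "E x y"
  shows "b1 = [] \<and> b2 = [] \<and> a1 \<noteq> [] \<and> a2 \<noteq> [] \<or> a1 = [] \<and> a2 = [] \<and> b1 \<noteq> [] \<and> b2 \<noteq> []"
proof -
  note t = min_three_pathsD(1)[OF min, unfolded three_paths_def]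
  have "b2 \<noteq> [] \<longrightarrow> a1 = []"
    using min_three_paths_opposite[OF min \<open>E x y\<close>] by blast
  moreover have "a2 \<noteq> [] \<longrightarrow> b1 = []"
    using min_three_paths_opposite[OF min_three_paths_swap12[OF min] sym[OF \<open>E x y\<close>]] by blast
  moreover have "\<not> (a1 = [] \<and> b1 = [])"
    using t \<open>E x y\<close> no_triangle[of u x y] sym[of u y] by auto
  moreover have "\<not> (a2 = [] \<and> b2 = [])"
    using t \<open>E x y\<close> no_triangle[of x y v] sym[of x v]
      walk_append_Cons[of "u # a1" x "[v]"] walk_append_Cons[of "u # b1" y "[v]"] by auto
  ultimately show ?thesis by blast
qed

text \<open>Both \<open>y\<close> and \<open>z\<close> are adjacent to both ends, so
  \<open>[u]\<close>, \<open>[v]\<close> and \<open>m\<close> would be the interiors of three paths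
  from \<open>y\<close> to \<open>z\<close>. Their total length \<open>length m + 2\<close> falls
  short of the old total by the lengths of \<open>a1\<close> and \<open>a2\<close>.\<close>

lemma min_three_paths_no_detour:
  assumes min: "min_three_paths u v (a1 @ m @ a2) [y] [z]" and "m \<noteq> []" and "a1 \<noteq> []"
  shows "\<not> walk (y # m @ [z])"
proof
  assume w: "walk (y # m @ [z])"
  note t = min_three_pathsD(1)[OF min, unfolded three_paths_def]
  have "three_paths y z [u] [v] m"
    using t w assms(2) unfolding three_paths_def by (auto simp: sym_iff)
  from min_three_pathsD(2)[OF min this] show False using assms(3) by simp
qed

text \<open>The segment of \<open>a\<close> between a neighbour of \<open>y\<close> and a neighbour
  of \<open>z\<close> is a forbidden detour, possibly consisting of one vertex.\<close>

lemma min_three_paths_two_short: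
  assumes min: "min_three_paths u v a [y] [z]"
    and x: "x \<in> set a" "E x y" and x': "x' \<in> set a" "E x' z"
  shows False
proof -
  note t = min_three_pathsD(1)[OF min, unfolded three_paths_def]
  have walk_a: "walk a" using t by (auto simp: successively_append_iff successively_Cons)
  note min' = min_three_paths_swap23[OF min]
  \<comment> \<open>The path through \<open>y\<close> has nothing beside \<open>y\<close>, so of the
    two cases for a cross edge only the one with vertices of \<open>a\<close> on both sides of
    \<open>x\<close> remains.\<close>
  have ne: "a1 \<noteq> []" if "a = a1 @ x # a2" for a1 a2
    using min_three_paths_cross_edge[of u v a1 x a2 "[]" y "[]" "[z]"] min x that by auto
  have ne': "a1 \<noteq> []" if "a = a1 @ x' # a2" for a1 a2
    using min_three_paths_cross_edge[of u v a1 x' a2 "[]" z "[]" "[y]"] min' x' that by auto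
  show False
  proof (cases "x = x'")
    case True
    obtain a1 a2 where a: "a = a1 @ x # a2" using x(1) by (metis split_list)
    show False
      using min_three_paths_no_detour[of u v a1 "[x]" a2 y z] min ne[OF a] a x x' sym[of x y] True by auto
  next
    case False
    from split_list_two[OF x(1) x'(1) this]
    consider (before) l1 l2 l3 where "a = l1 @ x # l2 @ x' # l3"
      | (after) l1 l2 l3 where "a = l1 @ x' # l2 @ x # l3" by metis
    then show False
    proof cases
      case before
      have "walk (y # (x # l2 @ [x']) @ [z])"
        using walk_a x(2) x'(2) sym[of x y] walk_append_Cons[of l1 x "l2 @ x' # l3"]
          walk_append_Cons[of "x # l2" x' l3] walk_append_Cons[of "x # l2" x' "[z]"]
        unfolding before by simp
      then show ?thesis
        using min_three_paths_no_detour[of u v l1 "x # l2 @ [x']" l3 y z] min ne[OF before] before by auto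
    next
      case after
      have "walk (z # (x' # l2 @ [x]) @ [y])"
        using walk_a x(2) x'(2) sym[of x' z] walk_append_Cons[of l1 x' "l2 @ x # l3"]
          walk_append_Cons[of "x' # l2" x l3] walk_append_Cons[of "x' # l2" x "[y]"]
        unfolding after by simp
      then show ?thesis
        using min_three_paths_no_detour[of u v l1 "x' # l2 @ [x]" l3 z y] min' ne'[OF after] after by auto
    qed
  qed
qed

text \<open>These are the non-edges that make the cycle through \<open>a\<close> and
  \<open>c\<close> induced. An edge \<open>u v\<close> would form a triangle with \<open>y\<close>.
  An edge from \<open>a\<close> to \<open>c\<close> would force one of these interiors to be a
  single vertex; it cannot be \<open>a\<close>, and for \<open>c\<close> the preceding lemma
  applies.\<close>

lemma min_three_paths_hub:
  assumes min: "min_three_paths u v a [y] c" and x: "x \<in> set a" "E x y"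
  shows "\<not> E u v" and "\<And>s t. s \<in> set a \<Longrightarrow> t \<in> set c \<Longrightarrow> \<not> E s t"
proof -
  note t = min_three_pathsD(1)[OF min, unfolded three_paths_def]
  show "\<not> E u v" using no_triangle[of u y v] t sym[of u v] by auto
  fix s t assume st: "s \<in> set a" "t \<in> set c"
  obtain a1 a2 where a: "a = a1 @ x # a2" using x(1) by (metis split_list)
  have "a1 \<noteq> []"
    using min_three_paths_cross_edge[of u v a1 x a2 "[]" y "[]" c] min x a by auto
  obtain s1 s2 where s: "a = s1 @ s # s2" using st by (metis split_list)
  obtain t1 t2 where tt: "c = t1 @ t # t2" using st by (metis split_list)
  show "\<not> E s t"
  proof
    assume "E s t"
    have "t1 = [] \<and> t2 = [] \<or> s1 = [] \<and> s2 = []"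
      using min_three_paths_cross_edge[of u v s1 s s2 t1 t t2 "[y]"]
        min_three_paths_swap23[OF min] \<open>E s t\<close> s tt by auto
    then have "c = [t]" using tt s a \<open>a1 \<noteq> []\<close> by (auto simp: append_eq_Cons_conv)
    then show False using min_three_paths_two_short[of u v a y t x s] min x st \<open>E s t\<close> by simp
  qed
qed

section \<open>Longest cycles\<close>

definition cyc :: "'a list \<Rightarrow> bool" where
  "cyc p \<longleftrightarrow> distinct p \<and> length p \<ge> 3 \<and> walk (p @ [hd p])"

lemma cyc_rotate:
  assumes "cyc (p @ c # q)"
  shows "cyc (c # q @ p)"
proof (cases p)
  case Nil
  then show ?thesis using assms by simp
next
  case (Cons h t)
  have "walk (p @ c # q @ [h])" using assms Cons unfolding cyc_def by simp
  then have "walk (p @ [c])" "walk (c # q @ [h])" using walk_append_Cons[of p c "q @ [h]"] by auto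
  then have "walk (c # q @ p @ [c])" using walk_append_Cons[of "c # q" h "t @ [c]"] Cons by simp
  then show ?thesis using assms unfolding cyc_def by auto
qed

text \<open>If \<open>c\<close> and \<open>d\<close> were consecutive on the cycle, inserting
  \<open>q\<close> between them would lengthen it. So both arcs of the cycle have interior vertices
  and form, with the ear, the three paths.\<close>

lemma longest_cyc_ear:
  assumes cyc: "cyc (c # a @ d # b)"
    and longest: "\<And>p. cyc p \<Longrightarrow> length p \<le> length (c # a @ d # b)"
    and q: "distinct q" "q \<noteq> []" "set q \<inter> set (c # a @ d # b) = {}" "walk (c # q @ [d])"
  shows "three_paths c d a (rev b) q"
proof -
  have dist: "distinct (c # a @ d # b @ q)" using cyc q unfolding cyc_def by auto
  have "walk (c # a @ d # b @ [c])" using cyc unfolding cyc_def by simp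
  then have a: "walk (c # a @ [d])" and b: "walk (d # b @ [c])"
    using walk_append_Cons[of "c # a" d "b @ [c]"] by auto
  have b': "walk (c # rev b @ [d])" using b walk_rev[of "d # b @ [c]"] by simp
  have q': "walk (d # rev q @ [c])" using q(4) walk_rev[of "c # q @ [d]"] by simp
  have len: "length (a @ b) > 0"
    using cyc unfolding cyc_def by (simp add: Suc_le_eq del: length_greater_0_conv)
  have "a \<noteq> []"
  proof
    assume "a = []"
    then have "cyc (c # q @ d # b)"
      using dist walk_append_Cons[of "c # q" d "b @ [c]"] b q(2,4) len unfolding cyc_def
      by (auto simp: Suc_le_eq)
    then show False using longest \<open>a = []\<close> q(2) by fastforce
  qed
  moreover have "b \<noteq> []"
  proof
    assume "b = []"
    then have "cyc (c # a @ d # rev q)"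
      using dist walk_append_Cons[of "c # a" d "rev q @ [c]"] a q(2) q' len unfolding cyc_def
      by (auto simp: Suc_le_eq)
    then show False using longest \<open>b = []\<close> q(2) by fastforce
  qed
  ultimately show ?thesis
    using dist a b' q unfolding three_paths_def by auto
qed

lemma walk_first_hit:
  assumes "distinct p" "walk p" "p \<noteq> []" "hd p \<notin> A" "last p \<in> A"
  obtains q d where "q \<noteq> []" "hd q = hd p" "set q \<inter> A = {}" "d \<in> A" "d \<in> set p"
    "distinct q" "walk (q @ [d])"
proof -
  have "\<exists>x\<in>set p. x \<in> A" using assms(3,5) by (meson last_in_set)
  then obtain q d r where p: "p = q @ d # r" and d: "d \<in> A" and q: "\<forall>x\<in>set q. x \<notin> A"
    using split_list_first_prop[of p "\<lambda>x. x \<in> A"] by blast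
  have "q \<noteq> []" using p d assms(4) by auto
  moreover have "walk (q @ [d])" using assms(2) walk_append_Cons[of q d r] p by simp
  ultimately show ?thesis using that[of q d] p d q assms(1) by auto
qed

text \<open>The assumption \<open>conn\<close> expresses 2-connectivity: deleting any one vertex
  leaves the rest joined by paths. If a longest cycle misses a vertex, two uses of
  \<open>conn\<close> produce an ear.\<close>

lemma spanning_cyc_or_three_paths:
  assumes fin: "finite V" and card: "card V > 2" and inV: "\<And>x y. E x y \<Longrightarrow> x \<in> V"
    and conn: "\<And>x u v. u \<in> V - {x} \<Longrightarrow> v \<in> V - {x} \<Longrightarrow>
      \<exists>p. distinct p \<and> walk p \<and> p \<noteq> [] \<and> hd p = u \<and> last p = v \<and> x \<notin> set p"
  shows "(\<exists>p. cyc p \<and> set p = V) \<or> (\<exists>u v a b c. three_paths u v a b c)"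
proof -
  have third: "\<exists>w\<in>V. w \<noteq> x \<and> w \<noteq> y" for x y
  proof (rule ccontr)
    assume "\<not> ?thesis"
    then have "V \<subseteq> {x, y}" by auto
    then have "card V \<le> card {x, y}" by (intro card_mono) auto
    also have "\<dots> \<le> 2" by (simp add: card_insert_if)
    finally show False using card by simp
  qed
  have nb: "\<exists>s. s \<noteq> x \<and> E u s" if u: "u \<in> V" "u \<noteq> x" for u x
  proof -
    obtain w where w: "w \<in> V" "w \<noteq> u" "w \<noteq> x" using third by blast
    then obtain p where p: "walk p" "p \<noteq> []" "hd p = u" "last p = w" "x \<notin> set p"
      using conn[of u x w] u by auto
    then obtain s q where "p = u # s # q" using w by (metis last.simps list.collapse)
    then show ?thesis using p by auto
  qed
  \<comment> \<open>Two distinct neighbours of \<open>u\<close> are joined by a path avoiding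
    \<open>u\<close>, which closes up through \<open>u\<close>.\<close>
  have "\<exists>p. cyc p"
  proof -
    obtain u where u: "u \<in> V" using third by blast
    then obtain x where x: "x \<in> V" "x \<noteq> u" using third by blast
    obtain s where s: "E u s" using nb u x by metis
    then have "s \<noteq> u" using irrefl by blast
    then obtain t where t: "t \<noteq> s" "E u t" using nb u by metis
    then have "t \<noteq> u" using irrefl by blast
    then obtain p where p: "distinct p" "walk p" "p \<noteq> []" "hd p = s" "last p = t" "u \<notin> set p"
      using conn[of s u t] inV sym s t \<open>s \<noteq> u\<close> by blast
    have "length p \<noteq> 1" using p t by (auto simp: length_Suc_conv)
    then have "length p \<ge> 2" using p(3) by (cases p) (auto simp: Suc_le_eq)
    moreover have "walk (u # p @ [u])"
      using p s t sym by (auto simp: successively_append_iff successively_Cons)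
    ultimately have "cyc (u # p)" using p unfolding cyc_def by simp
    then show ?thesis ..
  qed
  moreover have cycV: "set p \<subseteq> V" if "cyc p" for p
  proof
    fix x assume "x \<in> set p"
    then obtain p1 p2 where "p = p1 @ x # p2" by (metis split_list)
    then have "cyc (x # p2 @ p1)" using that cyc_rotate by simp
    then have "walk (x # (p2 @ p1 @ [x]))" unfolding cyc_def by simp
    then show "x \<in> V" using inV unfolding successively_Cons by blast
  qed
  then have "\<forall>p. cyc p \<longrightarrow> length p < Suc (card V)"
    using card_mono[OF fin] distinct_card unfolding cyc_def by (metis less_Suc_eq_le)
  ultimately obtain p where p: "cyc p" and longest: "\<And>q. cyc q \<Longrightarrow> length q \<le> length p"
    using ex_has_greatest_nat[of cyc _ length] by blast
  show ?thesis
  proof (cases "set p = V")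
    case True
    then show ?thesis using p by blast
  next
    case False
    then obtain w where w: "w \<in> V" "w \<notin> set p" using cycV[OF p] by blast
    have other: "\<exists>y\<in>set p. y \<noteq> x" for x
      using p unfolding cyc_def by (cases p rule: remdups_adj.cases) auto
    obtain z where z: "z \<in> set p" using other by blast
    obtain z' where z': "z' \<in> set p" "z' \<noteq> z" using other by blast
    \<comment> \<open>The vertex \<open>z'\<close> serves as the deleted vertex in
      \<open>conn\<close>; it differs from both \<open>w\<close> and \<open>z\<close>.\<close>
    obtain r where r: "distinct r" "walk r" "r \<noteq> []" "hd r = w" "last r = z"
      using conn[of w z' z] w z z' cycV[OF p] by blast
    obtain q c where q: "q \<noteq> []" "set q \<inter> set p = {}" and c: "c \<in> set p" and "walk (q @ [c])"
      using walk_first_hit[of r "set p"] r w z by metis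
    then have qc: "E (last q) c" by (auto simp: successively_append_iff)
    have q_out: "last q \<notin> set p" using q by (meson disjoint_iff last_in_set)
    obtain d0 where d0: "d0 \<in> set p" "d0 \<noteq> c" using other by blast
    \<comment> \<open>Only the last vertex of \<open>q\<close>, an outside neighbour of
      \<open>c\<close>, is kept. A path from it to the cycle that avoids \<open>c\<close> first
      meets the cycle at some \<open>d\<close> other than \<open>c\<close>; its part before
      \<open>d\<close> is the interior of the ear.\<close>
    obtain r' where r': "distinct r'" "walk r'" "r' \<noteq> []" "hd r' = last q" "last r' = d0" "c \<notin> set r'"
      using conn[of "last q" c d0] inV[OF qc] q_out c d0 cycV[OF p] by blast
    obtain q' d where q': "q' \<noteq> []" "hd q' = last q" "set q' \<inter> set p = {}" "distinct q'"
      "walk (q' @ [d])" and d: "d \<in> set p" "d \<in> set r'"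
      using walk_first_hit[of r' "set p"] r' q_out d0 by metis
    have "d \<noteq> c" using d r' by blast
    obtain p1 p2 where p12: "p = p1 @ c # p2" using c by (metis split_list)
    then have "d \<in> set (p2 @ p1)" using d \<open>d \<noteq> c\<close> by auto
    then obtain a b where ab: "p2 @ p1 = a @ d # b" by (metis split_list)
    have sets: "set (c # a @ d # b) = set p" "length (c # a @ d # b) = length p"
      unfolding ab[symmetric] p12 by auto
    have "cyc (c # a @ d # b)" using cyc_rotate p p12 ab by metis
    moreover have "walk (c # q' @ [d])"
      using q' sym[OF qc] by (simp add: successively_Cons)
    ultimately have "three_paths c d a (rev b) q'"
      using longest_cyc_ear q' longest sets by metis
    then show ?thesis by blast
  qed
qed

end

section \<open>Induced subgraphs and 2-connectivity\<close>

text \<open>The pattern can be the induced subgraph itself, with the identity as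
  isomorphism.\<close>

lemma has_inducedI:
  fixes G :: "'a pair_pre_digraph"
  assumes "pair_graph G" "S \<subseteq> pverts G" "P \<lparr> pverts = S, parcs = parcs G \<inter> S \<times> S \<rparr>"
  shows "has_induced P G"
proof -
  interpret pair_graph G by fact
  let ?H = "\<lparr> pverts = S, parcs = parcs G \<inter> S \<times> S \<rparr>"
  have wf: "wf_digraph (with_proj ?H)" by unfold_locales auto
  have "induced_subgraph (with_proj ?H) (with_proj G)"
    using assms(2) wf wf_digraph_axioms
    by (intro induced_subgraphI subgraphI) auto
  moreover have "digraph_iso (with_proj ?H) (with_proj ?H)"
    unfolding digraph_iso_def
  proof (intro exI conjI)
    let ?f = "\<lparr> iso_verts = id, iso_arcs = id, iso_head = snd, iso_tail = fst \<rparr>"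
    show "pre_digraph.digraph_isomorphism (with_proj ?H) ?f"
      using wf unfolding pre_digraph.digraph_isomorphism_def by simp
    show "with_proj ?H = app_iso ?f (with_proj ?H)"
      unfolding app_iso_def with_proj_def by simp
  qed
  ultimately show ?thesis using assms(3) unfolding has_induced_def by blast
qed

lemma triangle_free_imp_no_triangle:
  assumes "pair_graph G" "triangle_free G" "(x, y) \<in> parcs G" "(y, z) \<in> parcs G"
  shows "(z, x) \<notin> parcs G"
proof
  interpret pair_graph G by fact
  assume zx: "(z, x) \<in> parcs G"
  let ?V = "{x, y, z}"
  let ?T = "\<lparr> pverts = ?V, parcs = ?V \<times> ?V - Id \<rparr>"
  have ne: "x \<noteq> y" "y \<noteq> z" "z \<noteq> x" using assms zx no_loops' by blast+
  have "wf_digraph (with_proj ?T)" by unfold_locales auto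
  then have "subgraph (with_proj ?T) (with_proj G)"
    using assms(3,4) zx arcs_symmetric in_arcsD1 wf_digraph_axioms
    by (intro subgraphI) auto
  moreover have "complete_digraph 3 (with_proj ?T)"
    unfolding complete_digraph_pair_def using ne by auto
  ultimately show False using assms(2) unfolding triangle_free_def by blast
qed

lemma two_connected_path:
  assumes "pair_graph G" "k_connected 2 G" "u \<in> pverts G - {x}" "v \<in> pverts G - {x}"
  shows "\<exists>p. distinct p \<and> successively (\<lambda>s t. (s, t) \<in> parcs G) p \<and> p \<noteq> [] \<and>
    hd p = u \<and> last p = v \<and> x \<notin> set p"
proof -
  interpret pair_graph G by fact
  \<comment> \<open>Since \<open>x\<close> may lie outside \<open>G\<close>, the intersection keeps
    the deleted set within the vertices; it has at most one element.\<close>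
  let ?X = "{x} \<inter> pverts G"
  let ?H = "with_proj G \<restriction> (pverts G - ?X)"
  have "card ?X \<le> card {x}" by (intro card_mono) auto
  then have "connected ?H" using assms(2) unfolding k_connected_def by auto
  then have "u \<rightarrow>\<^sup>*\<^bsub>with_proj (mk_symmetric ?H)\<^esub> v"
    using assms(3,4) unfolding connected_def strongly_connected_def by auto
  then have "(u, v) \<in> rtrancl_on (pverts G - {x}) (parcs (mk_symmetric ?H))"
    unfolding reachable_def by (simp add: Diff_Int)
  then show ?thesis
  proof (induction rule: rtrancl_on_induct)
    case base
    show ?case by (rule exI[of _ "[u]"]) (use assms(3) in auto)
  next
    case (step s t)
    then obtain p where p: "distinct p" "successively (\<lambda>s t. (s, t) \<in> parcs G) p" "p \<noteq> []"
      "hd p = u" "last p = s" "x \<notin> set p" by blast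
    \<comment> \<open>Connectivity is defined through the symmetric closure, which adds nothing new
      because \<open>G\<close> is symmetric.\<close>
    have st: "(s, t) \<in> parcs G"
      using step arcs_symmetric by (auto simp: parcs_mk_symmetric)
    show ?case
    proof (cases "t \<in> set p")
      case True
      \<comment> \<open>A revisited vertex is handled by cutting the path off at it, which preserves
        distinctness.\<close>
      then obtain p1 p2 where p12: "p = p1 @ t # p2" by (metis split_list)
      then have "hd (p1 @ [t]) = u" using p by (cases p1) auto
      then show ?thesis using p p12
        by (intro exI[of _ "p1 @ [t]"]) (auto simp: successively_append_iff)
    next
      case False
      then show ?thesis using p st step
        by (intro exI[of _ "p @ [t]"]) (auto simp: successively_append_iff)
    qed
  qed
qed

lemma successively_has_neighbour:
  assumes "successively R p" "length p \<ge> 2" "x \<in> set p"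
  shows "\<exists>y. R x y \<or> R y x"
proof -
  obtain p1 p2 where p: "p = p1 @ x # p2" using assms(3) by (metis split_list)
  show ?thesis
  proof (cases p2)
    case Nil
    then have "p1 \<noteq> []" using assms(2) p by auto
    then show ?thesis using assms(1) p by (auto simp: successively_append_iff)
  next
    case (Cons y q)
    then show ?thesis using assms(1) p by (auto simp: successively_append_iff)
  qed
qed

lemma parcs_walk_graph_subset: "parcs (walk_graph p) \<subseteq> set p \<times> set p"
  unfolding walk_graph_def by (auto simp: in_vwalk_arcs_iff)

section \<open>Induced thetas, closed thetas and wheels from smallest configurations\<close>

locale triangle_free_graph = pair_graph G + adj: triangle_free_relation "\<lambda>x y. (x, y) \<in> parcs G"
  for G :: "'a pair_pre_digraph"
begin

text \<open>With at least two entries, every vertex of the walk is incident with an arc and hence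
  lies in \<open>G\<close>; a one-element list is a walk wherever its vertex lies.\<close>

lemma walk_subgraph:
  assumes "adj.walk p" "length p \<ge> 2"
  shows "set p \<subseteq> pverts G" "parcs (walk_graph p) \<subseteq> parcs G"
proof -
  show "set p \<subseteq> pverts G"
    using successively_has_neighbour[OF assms] in_arcsD1 in_arcsD2 by blast
  show "parcs (walk_graph p) \<subseteq> parcs G"
    using assms(1) arcs_symmetric unfolding walk_graph_def successively_iff_vwalk_arcs by auto
qed

lemma three_paths_subgraph:
  assumes "adj.three_paths u v a b c" "l \<in> {a, b, c}"
  shows "set (u # l @ [v]) \<subseteq> pverts G" "parcs (walk_graph (u # l @ [v])) \<subseteq> parcs G"
proof -
  have "adj.walk (u # l @ [v])" using assms unfolding adj.three_paths_def by auto
  then show "set (u # l @ [v]) \<subseteq> pverts G" "parcs (walk_graph (u # l @ [v])) \<subseteq> parcs G"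
    using walk_subgraph[of "u # l @ [v]"] by auto
qed

text \<open>The rim \<open>p\<close> runs through \<open>a\<close> and back through
  \<open>c\<close>; it is induced because neither path has a chord, \<open>u v\<close> is not an
  edge, and no edge joins \<open>a\<close> to \<open>c\<close>. The centre is
  \<open>y\<close>.\<close>

lemma hub_imp_induced_wheel:
  assumes min: "adj.min_three_paths u v a [y] c" and x: "x \<in> set a" "(x, y) \<in> parcs G"
  shows "has_induced is_wheel G"
proof -
  note t = adj.min_three_pathsD(1)[OF min]
  note t' = t[unfolded adj.three_paths_def]
  define p where "p = u # a @ v # rev c"
  define N where "N = {w \<in> set p. (y, w) \<in> parcs G}"
  have set_p: "set p = set (u # a @ [v]) \<union> set (u # c @ [v])" unfolding p_def by auto
  have y: "y \<notin> set p" using t' unfolding p_def by auto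
  have verts: "insert y (set p) \<subseteq> pverts G"
    using three_paths_subgraph(1)[OF t, of a] three_paths_subgraph(1)[OF t, of "[y]"]
      three_paths_subgraph(1)[OF t, of c] set_p by auto
  have cyc: "is_cycle (walk_graph (p @ [hd p]))"
    unfolding is_cycle_def using t' by (intro exI[of _ p]) (auto simp: p_def Suc_le_eq)
  have arcs_W: "parcs (walk_graph (p @ [hd p]))
      = parcs (walk_graph (u # a @ [v])) \<union> parcs (walk_graph (u # c @ [v]))"
    using parcs_walk_graph_cycle[of u a v c] unfolding p_def by simp
  have uv: "(u, v) \<notin> parcs G" and ac: "\<And>s t. s \<in> set a \<Longrightarrow> t \<in> set c \<Longrightarrow> (s, t) \<notin> parcs G"
    using adj.min_three_paths_hub[OF min x] by blast+
  have "parcs G \<inter> set p \<times> set p = parcs (walk_graph (p @ [hd p]))"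
  proof
    show "parcs (walk_graph (p @ [hd p])) \<subseteq> parcs G \<inter> set p \<times> set p"
      using three_paths_subgraph(2)[OF t] parcs_walk_graph_subset[of "p @ [hd p]"]
      unfolding arcs_W by (auto simp: p_def)
    show "parcs G \<inter> set p \<times> set p \<subseteq> parcs (walk_graph (p @ [hd p]))"
    proof
      fix e assume e: "e \<in> parcs G \<inter> set p \<times> set p"
      then obtain s t where st: "e = (s, t)" "(s, t) \<in> parcs G" "s \<in> set p" "t \<in> set p" by auto
      have "{s, t} \<noteq> {u, v}" using uv st(2) arcs_symmetric by (auto simp: doubleton_eq_iff)
      moreover have "s \<in> set (u # a @ [v]) \<and> t \<in> set (u # a @ [v]) \<or>
          s \<in> set (u # c @ [v]) \<and> t \<in> set (u # c @ [v])"
        using st ac[of s t] ac[of t s] arcs_symmetric[OF st(2)] unfolding p_def by auto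
      ultimately show "e \<in> parcs (walk_graph (p @ [hd p]))"
        \<comment> \<open>The two swaps bring \<open>c\<close> to the first position, so that
          chordlessness applies to it as well.\<close>
        using adj.min_three_paths_chordless[OF min, of s t]
          adj.min_three_paths_chordless
            [OF adj.min_three_paths_swap12[OF adj.min_three_paths_swap23[OF min]], of s t]
          st unfolding arcs_W by blast
    qed
  qed
  moreover have "parcs G \<inter> insert y (set p) \<times> insert y (set p)
      = parcs G \<inter> set p \<times> set p \<union> parcs G \<inter> {y} \<times> set p \<union> parcs G \<inter> set p \<times> {y}"
    using adj.irrefl[of y] by auto
  moreover have "parcs G \<inter> {y} \<times> set p = {y} \<times> N" unfolding N_def by auto
  moreover have "parcs G \<inter> set p \<times> {y} = N \<times> {y}"
    unfolding N_def using adj.sym_iff[of _ y] by auto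
  ultimately have arcs: "parcs G \<inter> insert y (set p) \<times> insert y (set p)
      = parcs (walk_graph (p @ [hd p])) \<union> {y} \<times> N \<union> N \<times> {y}"
    by simp
  \<comment> \<open>The three required spokes: \<open>y\<close> is the only interior vertex of its
    path, hence adjacent to both ends, and \<open>x\<close> is its neighbour in
    \<open>a\<close>.\<close>
  have "{u, v, x} \<subseteq> N"
    using t' x arcs_symmetric[of u y] arcs_symmetric[of x y] unfolding N_def p_def by auto
  moreover have "u \<noteq> v" "u \<noteq> x" "v \<noteq> x" using t' x(1) by auto
  then have "card {u, v, x} = 3" by simp
  moreover have "finite N" unfolding N_def by simp
  ultimately have "card N \<ge> 3" by (metis card_mono)
  moreover have "pverts (walk_graph (p @ [hd p])) = set p" unfolding walk_graph_def p_def by auto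
  ultimately have "is_wheel \<lparr> pverts = insert y (set p),
      parcs = parcs G \<inter> insert y (set p) \<times> insert y (set p) \<rparr>"
    unfolding is_wheel_def arcs using cyc y
    by (intro exI[of _ "walk_graph (p @ [hd p])"] exI[of _ y] exI[of _ N]) (auto simp: N_def)
  then show ?thesis using has_inducedI[OF pair_graph verts] by blast
qed

lemma cross_edge_imp_induced_wheel:
  assumes min: "adj.min_three_paths u v a b c" and "x \<in> set a" "y \<in> set b" "(x, y) \<in> parcs G"
  shows "has_induced is_wheel G"
proof -
  obtain a1 a2 where a: "a = a1 @ x # a2" using assms by (metis split_list)
  obtain b1 b2 where b: "b = b1 @ y # b2" using assms by (metis split_list)
  from adj.min_three_paths_cross_edge[OF min[unfolded a b] assms(4)]
  consider "b = [y]" | "a = [x]" using a b by auto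
  then show ?thesis
  proof cases
    case 1
    then show ?thesis using hub_imp_induced_wheel min assms by blast
  next
    case 2
    then show ?thesis
      using hub_imp_induced_wheel[of u v b x c y] adj.min_three_paths_swap12[OF min] assms
        arcs_symmetric by blast
  qed
qed

text \<open>In a smallest configuration, an edge between two interiors yields a wheel. Otherwise the
  only edge that can occur beyond the three paths is \<open>u v\<close>, and its presence decides
  between closed theta and theta.\<close>

lemma three_paths_imp_induced:
  assumes "adj.three_paths u v a b c"
  shows "has_induced is_theta G \<or> has_induced is_closed_theta G \<or> has_induced is_wheel G"
proof (rule ccontr)
  assume neg: "\<not> ?thesis"
  \<comment> \<open>From here on the names denote a smallest configuration in place of the given
    one.\<close>
  obtain u v a b c where min: "adj.min_three_paths u v a b c"
    using adj.ex_min_three_paths[OF assms] by blast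
  note t = adj.min_three_pathsD(1)[OF min]
  note t' = t[unfolded adj.three_paths_def]
  note minb = adj.min_three_paths_swap12[OF min]
  note minc = adj.min_three_paths_swap12[OF adj.min_three_paths_swap23[OF min]]
  define S where "S = set (u # a @ [v]) \<union> set (u # b @ [v]) \<union> set (u # c @ [v])"
  define A where "A = parcs (walk_graph (u # a @ [v])) \<union> parcs (walk_graph (u # b @ [v]))
    \<union> parcs (walk_graph (u # c @ [v]))"
  have verts: "S \<subseteq> pverts G" using three_paths_subgraph(1)[OF t] unfolding S_def by auto
  have A: "A \<subseteq> parcs G \<inter> S \<times> S"
    using three_paths_subgraph(2)[OF t] parcs_walk_graph_subset unfolding S_def A_def by fast
  have cross: "(s, t) \<notin> parcs G"
    if "s \<in> set a \<and> t \<in> set b \<or> s \<in> set a \<and> t \<in> set c \<or> s \<in> set b \<and> t \<in> set c" for s t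
    using that neg cross_edge_imp_induced_wheel[OF min, of s t]
      cross_edge_imp_induced_wheel[OF adj.min_three_paths_swap23[OF min], of s t]
      cross_edge_imp_induced_wheel[OF adj.min_three_paths_swap23[OF minb], of s t] by blast
  have arc: "(s, t) \<in> A" if st: "(s, t) \<in> parcs G" "s \<in> S" "t \<in> S" "{s, t} \<noteq> {u, v}" for s t
  proof -
    have "s \<in> set (u # a @ [v]) \<and> t \<in> set (u # a @ [v]) \<or>
        s \<in> set (u # b @ [v]) \<and> t \<in> set (u # b @ [v]) \<or>
        s \<in> set (u # c @ [v]) \<and> t \<in> set (u # c @ [v])"
      using st cross[of s t] cross[of t s] arcs_symmetric[OF st(1)] unfolding S_def by auto
    then show ?thesis
      using adj.min_three_paths_chordless[OF min, of s t]
        adj.min_three_paths_chordless[OF minb, of s t]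
        adj.min_three_paths_chordless[OF minc, of s t] st(1,4) unfolding A_def by blast
  qed
  have len: "length (u # l @ [v]) \<ge> 3" if "l \<noteq> []" for l
    using that by (cases l) auto
  have theta: "theta_with_ends u v \<lparr> pverts = S, parcs = A \<rparr>"
    unfolding theta_with_ends_def S_def A_def
    by (intro exI[of _ "u # a @ [v]"] exI[of _ "u # b @ [v]"] exI[of _ "u # c @ [v]"])
      (use t' len in \<open>auto simp: disjnt_def simp del: length_Cons length_append\<close>)
  show False
  proof (cases "(u, v) \<in> parcs G")
    case True
    have uvS: "u \<in> S" "v \<in> S" unfolding S_def by auto
    have "parcs G \<inter> S \<times> S = A \<union> {(u, v), (v, u)}"
    proof
      show "A \<union> {(u, v), (v, u)} \<subseteq> parcs G \<inter> S \<times> S"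
        using A True arcs_symmetric uvS by auto
      show "parcs G \<inter> S \<times> S \<subseteq> A \<union> {(u, v), (v, u)}"
        using arc by (auto simp: doubleton_eq_iff)
    qed
    then have "is_closed_theta \<lparr> pverts = S, parcs = parcs G \<inter> S \<times> S \<rparr>"
      unfolding is_closed_theta_def using theta by force
    then show False using neg has_inducedI[OF pair_graph verts] by blast
  next
    case False
    then have "parcs G \<inter> S \<times> S = A"
      using A arc arcs_symmetric by (auto simp: doubleton_eq_iff)
    then have "is_theta \<lparr> pverts = S, parcs = parcs G \<inter> S \<times> S \<rparr>"
      unfolding is_theta_def using theta by auto
    then show False using neg has_inducedI[OF pair_graph verts] by blast
  qed
qed

end

theorem theorem10:
  fixes G :: "'a pair_pre_digraph"
  assumes "pair_graph G"
    and "triangle_free G"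
    and "k_connected 2 G"
    and "\<not> has_induced is_theta G"
    and "\<not> has_induced is_closed_theta G"
    and "\<not> has_induced is_wheel G"
  shows "\<exists>C. hamiltonian_cycle C G"
proof -
  interpret pair_graph G by fact
  interpret triangle_free_graph G
    using arcs_symmetric no_loops' triangle_free_imp_no_triangle[OF assms(1,2)]
    by unfold_locales blast+
  have "card (pverts G) > 2" using assms(3) unfolding k_connected_def by blast
  with pair_finite_verts have "(\<exists>p. adj.cyc p \<and> set p = pverts G) \<or>
      (\<exists>u v a b c. adj.three_paths u v a b c)"
    by (rule adj.spanning_cyc_or_three_paths)
      (blast dest: in_arcsD1, rule two_connected_path[OF assms(1,3)])
  \<comment> \<open>Three paths would yield one of the excluded induced subgraphs, so the spanning
    cycle remains.\<close>
  then obtain p where p: "adj.cyc p" "set p = pverts G"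
    using three_paths_imp_induced assms(4-6) by blast
  let ?C = "walk_graph (p @ [hd p])"
  have p': "distinct p" "length p \<ge> 3" "adj.walk (p @ [hd p])"
    using p(1) unfolding adj.cyc_def by auto
  have verts: "pverts ?C = pverts G" using p(2) p'(2) unfolding walk_graph_def by (cases p) auto
  have arcs: "parcs ?C \<subseteq> parcs G" using walk_subgraph(2)[OF p'(3)] p'(2) by simp
  have "wf_digraph (with_proj ?C)"
    using arcs verts in_arcsD1 in_arcsD2 by unfold_locales auto
  then have "spanning ?C G"
    unfolding spanning_def using verts arcs wf_digraph_axioms by (auto intro!: subgraphI)
  then have "hamiltonian_cycle ?C G"
    unfolding hamiltonian_cycle_def is_cycle_def using p' by blast
  then show ?thesis ..
qed

end
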